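(* Let $(C,\le)$ be a causal set, fix an integer $r\ge2$ and a real $K>0$, and suppose that $\kappa_r^{\mathrm{LLY}}(\gamma)\ge K$ for all maximising geodesics $\gamma=(x_0,\dots,x_{n+r})$ in $C$ and all integers $n\ge r$. Then for every such $\gamma$ $$\tau(x_0,x_{n+r})\le r+\frac{J_r^{\mathrm{LLY}}(\gamma)}{K},\qquad\text{where}\quad J_r^{\mathrm{LLY}}(\gamma):=\lim_{\alpha\to1}\frac{J_r^\alpha(\gamma)}{1-\alpha},\quad J_r^\alpha(\gamma):=r-\ell_1(\delta_{x_0},\mu_{x_0}^\alpha)-\ell_1(\mu_{x_n}^\alpha,\delta_{x_{n+r}}).$$ In particular, if $\mathrm{diam}_\tau(C)\ge 2r$, then $$\mathrm{diam}_\tau(C)\le r+\frac{\sup_\gamma J_r^{\mathrm{LLY}}(\gamma)}{K},$$ where the supremum is over all maximising geodesics $\gamma=(x_0,\dots,x_{n+r})$ with $n\ge r$; and for each such $\gamma$: if $r=2$, $$J_2^{\mathrm{LLY}}(\gamma)\le\frac1{N_y-1}-\frac1{N_x-1}\le\frac12,$$ while if $r>2$, $$J_r^{\mathrm{LLY}}(\gamma)\le r-2-\frac{r(r-1)}{2(N_x-1)}-\frac{r(r-3)}{2(N_y-1)}<r-2.$$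
   Context: A causal set is a pair $(C,\le)$ where $\le$ is a partial order on the set $C$ such that every causal diamond $J(x,z)=\{y\in C:x\le y\le z\}$ is finite. Write $x\ll y$ if $x\le y$ and $x\ne y$. The time separation is $\tau(x,y)=\max\{m: x=z_0\ll z_1\ll\dots\ll z_m=y\}$ if $x\le y$, and $\tau(x,y)=0$ otherwise; $\mathrm{diam}_\tau(C)=\sup\{\tau(x,y):x\le y\}$. A chain $x_0\ll\dots\ll x_m$ is a (maximising) geodesic if $m=\tau(x_0,x_m)$. For finitely supported probability measures $\mu,\nu$ on $C$, $\ell_1(\mu,\nu)=\max_\pi\sum_{a,b}\pi(a,b)\tau(a,b)$ over couplings $\pi$ of $\mu,\nu$ with $\pi(a,b)=0$ whenever $a\not\le b$ ($-\infty$ if none exist). For integers $n\ge r\ge1$, a maximising geodesic $\gamma=(x_0,\dots,x_{n+r})$ and $\alpha\in[0,1]$, put $x=x_0$, $y=x_n$, $N_x=|J(x,x_r)|$, $N_y=|J(y,x_{n+r})|$, $$\mu_{x_0}^\alpha=\mu_x^\alpha=\alpha\delta_x+\frac{1-\alpha}{N_x-1}\sum_{z\in J(x,x_r)\setminus\{x\}}\delta_z,\qquad \mu_{x_n}^\alpha=\mu_y^\alpha=\alpha\delta_y+\frac{1-\alpha}{N_y-1}\sum_{z\in J(y,x_{n+r})\setminus\{y\}}\delta_z,$$ $\kappa_r^\alpha(\gamma)=\frac{\ell_1(\mu_x^\alpha,\mu_y^\alpha)}{\tau(x,y)}-1$ and $\kappa_r^{\mathrm{LLY}}(\gamma)=\lim_{\alpha\to1}\frac{\kappa_r^\alpha(\gamma)}{1-\alpha}$.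 $\delta_z$ is the Dirac mass at $z$. *)

theory Defs
  imports "HOL-Probability.Probability"
begin

text \<open>A causal set is a carrier \<open>C\<close> together with the order as a relation \<open>R\<close>, where
  \<open>(a, b) \<in> R\<close> means \<open>a \<le> b\<close>; in particular \<open>R \<subseteq> C \<times> C\<close>.\<close>

definition diamond :: "'a rel \<Rightarrow> 'a \<Rightarrow> 'a \<Rightarrow> 'a set" where
  "diamond R x z = {y. (x, y) \<in> R \<and> (y, z) \<in> R}"

definition causal_set :: "'a set \<Rightarrow> 'a rel \<Rightarrow> bool" where
  "causal_set C R \<longleftrightarrow> partial_order_on C R \<and> (\<forall>x\<in>C. \<forall>z\<in>C. finite (diamond R x z))"

definition precedes :: "'a rel \<Rightarrow> 'a \<Rightarrow> 'a \<Rightarrow> bool" where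
  "precedes R x y \<longleftrightarrow> (x, y) \<in> R \<and> x \<noteq> y"

text \<open>Chains \<open>x 0, \<dots>, x m\<close> are functions on \<open>nat\<close> whose values beyond index \<open>m\<close> are irrelevant.\<close>

definition causal_chain :: "'a rel \<Rightarrow> nat \<Rightarrow> (nat \<Rightarrow> 'a) \<Rightarrow> bool" where
  "causal_chain R m x \<longleftrightarrow> (\<forall>i<m. precedes R (x i) (x (Suc i)))"

text \<open>In a causal set the set of lengths below is finite (a chain from \<open>x\<close> to \<open>y\<close> lies in the
  finite diamond between them) and nonempty whenever \<open>(x, y) \<in> R\<close>.\<close>

definition tau :: "'a rel \<Rightarrow> 'a \<Rightarrow> 'a \<Rightarrow> nat" where
  "tau R x y =
    (if (x, y) \<in> R then Max {m. \<exists>z. causal_chain R m z \<and> z 0 = x \<and> z m = y} else 0)"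

definition diam_tau :: "'a rel \<Rightarrow> enat" where
  "diam_tau R = (SUP (x, y)\<in>R. enat (tau R x y))"

definition geodesic :: "'a set \<Rightarrow> 'a rel \<Rightarrow> nat \<Rightarrow> (nat \<Rightarrow> 'a) \<Rightarrow> bool" where
  "geodesic C R m x \<longleftrightarrow>
    (\<forall>i\<le>m. x i \<in> C) \<and> causal_chain R m x \<and> m = tau R (x 0) (x m)"

definition causal_couplings :: "'a rel \<Rightarrow> 'a pmf \<Rightarrow> 'a pmf \<Rightarrow> ('a \<times> 'a) pmf set" where
  "causal_couplings R \<mu> \<nu> =
    {\<pi>. map_pmf fst \<pi> = \<mu> \<and> map_pmf snd \<pi> = \<nu> \<and> (\<forall>a b. (a, b) \<notin> R \<longrightarrow> pmf \<pi> (a, b) = 0)}"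

text \<open>Meant for finitely supported measures, for which the expectation is the finite sum of
  \<open>\<pi>(a, b) \<tau>(a, b)\<close> and the supremum is a maximum (of a linear function on a compact polytope)
  if a causal coupling exists. Without causal couplings the supremum is \<open>-\<infinity>\<close>.\<close>

definition ell1 :: "'a rel \<Rightarrow> 'a pmf \<Rightarrow> 'a pmf \<Rightarrow> ereal" where
  "ell1 R \<mu> \<nu> =
    (SUP \<pi>\<in>causal_couplings R \<mu> \<nu>.
      ereal (measure_pmf.expectation \<pi> (\<lambda>(a, b). real (tau R a b))))"

text \<open>The mixture of \<open>\<delta>\<^sub>x\<close> (weight \<open>\<alpha>\<close>) and the uniform distribution on \<open>J(x, w) - {x}\<close>
  (weight \<open>1 - \<alpha>\<close>), for \<open>0 \<le> \<alpha> \<le> 1\<close>.\<close>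

definition lazy_measure :: "'a rel \<Rightarrow> real \<Rightarrow> 'a \<Rightarrow> 'a \<Rightarrow> 'a pmf" where
  "lazy_measure R \<alpha> x w =
    bind_pmf (bernoulli_pmf \<alpha>)
      (\<lambda>b. if b then return_pmf x else pmf_of_set (diamond R x w - {x}))"

lemma pmf_lazy_measure:
  assumes "0 \<le> \<alpha>" "\<alpha> \<le> 1" "finite (diamond R x w)" "(x, x) \<in> R" "(x, w) \<in> R"
    and "diamond R x w - {x} \<noteq> {}"
  shows "pmf (lazy_measure R \<alpha> x w) z =
    \<alpha> * indicator {x} z
    + (1 - \<alpha>) / (real (card (diamond R x w)) - 1) * (\<Sum>v\<in>diamond R x w - {x}. indicator {v} z)"
proof -
  have x: "x \<in> diamond R x w"
    using assms by (simp add: diamond_def)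
  then have c: "real (card (diamond R x w - {x})) = real (card (diamond R x w)) - 1"
    using assms(3) by (metis card.remove add_diff_cancel_left' of_nat_Suc)
  have s: "(\<Sum>v\<in>diamond R x w - {x}. indicator {v} z) = (indicator (diamond R x w - {x}) z :: real)"
    using assms(3) by (auto simp: indicator_def)
  show ?thesis
    using assms unfolding lazy_measure_def s
    by (auto simp: pmf_bind integral_measure_pmf[of UNIV] UNIV_bool pmf_of_set c
        indicator_def field_simps)
qed

definition kappa :: "'a rel \<Rightarrow> nat \<Rightarrow> real \<Rightarrow> nat \<Rightarrow> (nat \<Rightarrow> 'a) \<Rightarrow> ereal" where
  "kappa R r \<alpha> n x =
    ell1 R (lazy_measure R \<alpha> (x 0) (x r)) (lazy_measure R \<alpha> (x n) (x (n + r)))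
      / ereal (real (tau R (x 0) (x n))) - 1"

definition kappa_LLY :: "'a rel \<Rightarrow> nat \<Rightarrow> nat \<Rightarrow> (nat \<Rightarrow> 'a) \<Rightarrow> ereal" where
  "kappa_LLY R r n x = Lim (at_left 1) (\<lambda>\<alpha>. kappa R r \<alpha> n x / ereal (1 - \<alpha>))"

definition J_defect :: "'a rel \<Rightarrow> nat \<Rightarrow> real \<Rightarrow> nat \<Rightarrow> (nat \<Rightarrow> 'a) \<Rightarrow> ereal" where
  "J_defect R r \<alpha> n x =
    ereal (real r)
      - ell1 R (return_pmf (x 0)) (lazy_measure R \<alpha> (x 0) (x r))
      - ell1 R (lazy_measure R \<alpha> (x n) (x (n + r))) (return_pmf (x (n + r)))"

definition J_LLY :: "'a rel \<Rightarrow> nat \<Rightarrow> nat \<Rightarrow> (nat \<Rightarrow> 'a) \<Rightarrow> ereal" where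
  "J_LLY R r n x = Lim (at_left 1) (\<lambda>\<alpha>. J_defect R r \<alpha> n x / ereal (1 - \<alpha>))"

end

theory Submission
  imports Defs
begin

text \<open>For \<open>\<alpha> < 1\<close> the quotient \<open>J\<^sub>r\<^sup>\<alpha>(\<gamma>) / (1 - \<alpha>)\<close> is the constant \<open>r - a - b\<close>, where \<open>a\<close> is the mean of
  \<open>\<tau>(x\<^sub>0, \<cdot>)\<close> over \<open>J(x\<^sub>0, x\<^sub>r) - {x\<^sub>0}\<close> and \<open>b\<close> the mean of \<open>\<tau>(\<cdot>, x\<^bsub>n+r\<^esub>)\<close> over \<open>J(x\<^sub>n, x\<^bsub>n+r\<^esub>) - {x\<^sub>n}\<close>.
  Integrating the reverse triangle inequality against a causal coupling of the two lazy measures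
  gives \<open>n \<kappa>\<^sub>r\<^sup>\<alpha>(\<gamma>) \<le> J\<^sub>r\<^sup>\<alpha>(\<gamma>)\<close>. Mixing couplings with the Dirac mass at \<open>(x\<^sub>0, x\<^sub>n)\<close> shows that
  \<open>\<kappa>\<^sub>r\<^sup>\<alpha>(\<gamma>) / (1 - \<alpha>)\<close> is nondecreasing in \<open>\<alpha>\<close>, so its limit exists and
  \<open>n K \<le> n \<kappa>\<^sub>r\<^sup>L\<^sup>L\<^sup>Y(\<gamma>) \<le> r - a - b\<close>. The bounds on \<open>r - a - b\<close> come from separating the points of the
  geodesic, whose time separations are known, from the other points of the diamonds, whose time
  separations are at least \<open>1\<close>.\<close>

section \<open>Time separation\<close>

locale causal =
  fixes C :: "'a set" and R :: "'a rel"
  assumes causal: "causal_set C R"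
begin

lemma refl: "x \<in> C \<Longrightarrow> (x, x) \<in> R"
  using causal by (auto simp: causal_set_def partial_order_on_def preorder_on_def refl_on_def)

lemma carrier: "(x, y) \<in> R \<Longrightarrow> x \<in> C \<and> y \<in> C"
  using causal by (auto simp: causal_set_def partial_order_on_def preorder_on_def)

lemma trans: "(x, y) \<in> R \<Longrightarrow> (y, z) \<in> R \<Longrightarrow> (x, z) \<in> R"
  using causal unfolding causal_set_def partial_order_on_def preorder_on_def by (meson transD)

lemma antisym: "(x, y) \<in> R \<Longrightarrow> (y, x) \<in> R \<Longrightarrow> x = y"
  using causal unfolding causal_set_def partial_order_on_def by (meson antisymD)

lemma finite_diamond: "finite (diamond R x z)"
proof (cases "x \<in> C \<and> z \<in> C")
  case True
  then show ?thesis using causal by (auto simp: causal_set_def)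
next
  case False
  then have "diamond R x z = {}" using carrier by (auto simp: diamond_def)
  then show ?thesis by simp
qed

lemma chain_le:
  assumes "causal_chain R m z" "z 0 \<in> C" "i \<le> j" "j \<le> m"
  shows "(z i, z j) \<in> R"
  using assms(3,4)
proof (induction j)
  case 0
  then show ?case using assms(2) refl by simp
next
  case (Suc j)
  have step: "(z j, z (Suc j)) \<in> R"
    using assms(1) Suc.prems by (auto simp: causal_chain_def precedes_def)
  show ?case
  proof (cases "i \<le> j")
    case True
    then show ?thesis using Suc step trans by (meson Suc_leD)
  next
    case False
    then have "i = Suc j" using Suc.prems by simp
    then show ?thesis using step carrier refl by blast
  qed
qed

lemma chain_neq:
  assumes "causal_chain R m z" "z 0 \<in> C" "i < j" "j \<le> m"
  shows "z i \<noteq> z j"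
proof
  assume eq: "z i = z j"
  have p: "precedes R (z i) (z (Suc i))"
    using assms by (auto simp: causal_chain_def)
  moreover have "(z (Suc i), z j) \<in> R"
    using chain_le[OF assms(1,2), of "Suc i" j] assms by simp
  ultimately show False using antisym eq by (auto simp: precedes_def)
qed

lemma chain_inj:
  assumes "causal_chain R m z" "z 0 \<in> C"
  shows "inj_on z {..m}"
  by (rule inj_onI) (metis assms atMost_iff chain_neq linorder_neqE_nat)

text \<open>The \<open>m + 1\<close> points of the chain are distinct and lie in the finite diamond
  of its endpoints. This makes the \<open>Max\<close> in \<open>tau\<close> one over a finite set,
  and later bounds the diamonds of the geodesic from below.\<close>

lemma chain_length_less_card:
  assumes "causal_chain R m z" "z 0 \<in> C"
  shows "m < card (diamond R (z 0) (z m))"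
proof -
  have "z ` {..m} \<subseteq> diamond R (z 0) (z m)"
    using chain_le[OF assms] by (auto simp: diamond_def)
  then have "card (z ` {..m}) \<le> card (diamond R (z 0) (z m))"
    using finite_diamond card_mono by blast
  then show ?thesis using card_image[OF chain_inj[OF assms]] by simp
qed

lemma finite_chain_lengths:
  assumes "x \<in> C"
  shows "finite {m. \<exists>z. causal_chain R m z \<and> z 0 = x \<and> z m = y}"
  by (rule finite_subset[of _ "{..<card (diamond R x y)}"])
    (use chain_length_less_card assms in blast, simp)

lemma chain_le_tau:
  assumes "causal_chain R m z" "z 0 \<in> C"
  shows "m \<le> tau R (z 0) (z m)"
proof -
  have "(z 0, z m) \<in> R" using chain_le[OF assms, of 0 m] by simp
  then show ?thesis
    using assms finite_chain_lengths[OF assms(2)] by (auto simp: tau_def intro!: Max_ge)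
qed

lemma tau_chain:
  assumes "(x, y) \<in> R"
  obtains z where "causal_chain R (tau R x y) z" "z 0 = x" "z (tau R x y) = y"
proof -
  let ?M = "{m. \<exists>z. causal_chain R m z \<and> z 0 = x \<and> z m = y}"
  have "\<exists>m. m \<in> ?M"
  proof (cases "x = y")
    case True
    then show ?thesis by (auto simp: causal_chain_def intro: exI[of _ 0])
  next
    case False
    then have "causal_chain R 1 (\<lambda>i. if i = 0 then x else y)"
      using assms by (auto simp: causal_chain_def precedes_def)
    then show ?thesis by (auto intro!: exI[of _ 1] exI[of _ "\<lambda>i. if i = 0 then x else y"])
  qed
  then have "Max ?M \<in> ?M"
    using finite_chain_lengths carrier[OF assms] by (intro Max_in) auto
  then show ?thesis using that assms by (auto simp: tau_def)
qed

text \<open>Longest chains from \<open>a\<close> to \<open>b\<close> and from \<open>b\<close> to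
  \<open>c\<close> concatenate to a chain from \<open>a\<close> to \<open>c\<close>, and
  \<open>tau R a c\<close> is at least its length.\<close>

lemma tau_triangle:
  assumes "(a, b) \<in> R" "(b, c) \<in> R"
  shows "tau R a b + tau R b c \<le> tau R a c"
proof -
  obtain y where y: "causal_chain R (tau R a b) y" "y 0 = a" "y (tau R a b) = b"
    using tau_chain[OF assms(1)] .
  obtain z where z: "causal_chain R (tau R b c) z" "z 0 = b" "z (tau R b c) = c"
    using tau_chain[OF assms(2)] .
  define w where "w i = (if i \<le> tau R a b then y i else z (i - tau R a b))" for i
  have "precedes R (w i) (w (Suc i))" if i: "i < tau R a b + tau R b c" for i
  proof -
    consider "i < tau R a b" | "i = tau R a b" | "i > tau R a b" by linarith
    then show ?thesis
    proof cases
      case 1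
      then show ?thesis using y(1) by (simp add: w_def causal_chain_def)
    next
      case 2
      \<comment> \<open>At the junction \<open>y\<close> ends where \<open>z\<close> starts, so the
        link is the first one of \<open>z\<close>.\<close>
      then have "precedes R (z 0) (z (Suc 0))"
        using z(1) i by (simp add: causal_chain_def)
      then show ?thesis using 2 y(3) z(2) by (simp add: w_def)
    next
      case 3
      then have "precedes R (z (i - tau R a b)) (z (Suc (i - tau R a b)))"
        using z(1) i by (simp add: causal_chain_def)
      then show ?thesis using 3 by (simp add: w_def Suc_diff_le)
    qed
  qed
  then have "causal_chain R (tau R a b + tau R b c) w"
    by (simp add: causal_chain_def)
  moreover have "w 0 = a" using y by (simp add: w_def)
  \<comment> \<open>If \<open>tau R b c = 0\<close>, the first branch of \<open>w\<close> applies,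
    and then \<open>b = z 0 = c\<close>.\<close>
  moreover have "w (tau R a b + tau R b c) = c"
    using y z by (auto simp: w_def)
  ultimately show ?thesis
    using chain_le_tau[of _ w] carrier[OF assms(1)] by metis
qed

lemma tau_ge_1:
  assumes "(a, b) \<in> R" "a \<noteq> b"
  shows "1 \<le> tau R a b"
  using tau_chain[OF assms(1)] assms(2) by (metis less_one not_le)

lemma subchain: "causal_chain R m x \<Longrightarrow> i + k \<le> m \<Longrightarrow> causal_chain R k (\<lambda>l. x (i + l))"
  by (simp add: causal_chain_def)

lemma geodesic_le:
  assumes "geodesic C R m x" "i \<le> j" "j \<le> m"
  shows "(x i, x j) \<in> R"
  using assms chain_le by (auto simp: geodesic_def)

lemma geodesic_inj: "geodesic C R m x \<Longrightarrow> inj_on x {..m}"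
  using chain_inj by (auto simp: geodesic_def)

text \<open>Cut the geodesic at \<open>i\<close> and \<open>j\<close>. Each of the three pieces has
  time separation at least its number of links, and by the reverse triangle inequality the three add
  up to at most \<open>m\<close>, so each is exact.\<close>

lemma geodesic_tau:
  assumes "geodesic C R m x" "i \<le> j" "j \<le> m"
  shows "tau R (x i) (x j) = j - i"
proof -
  have ge: "l - k \<le> tau R (x k) (x l)" if "k \<le> l" "l \<le> m" for k l
    using chain_le_tau[OF subchain[of m x k "l - k"]] that assms(1)
    by (auto simp: geodesic_def)
  have "tau R (x 0) (x i) + tau R (x i) (x j) \<le> tau R (x 0) (x j)"
    by (intro tau_triangle geodesic_le[OF assms(1)]) (use assms in auto)
  moreover have "tau R (x 0) (x j) + tau R (x j) (x m) \<le> tau R (x 0) (x m)"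
    by (intro tau_triangle geodesic_le[OF assms(1)]) (use assms in auto)
  moreover have "tau R (x 0) (x m) = m" using assms(1) by (simp add: geodesic_def)
  ultimately show ?thesis
    using ge[of 0 i] ge[of i j] ge[of j m] assms by linarith
qed

lemma geodesic_exists:
  assumes "(a, b) \<in> R"
  obtains x where "geodesic C R (tau R a b) x" "x 0 = a" "x (tau R a b) = b"
proof -
  obtain z where z: "causal_chain R (tau R a b) z" "z 0 = a" "z (tau R a b) = b"
    using tau_chain[OF assms] .
  have "z i \<in> C" if "i \<le> tau R a b" for i
    using chain_le[OF z(1), of 0 i] z(2) carrier[OF assms] that carrier by auto
  then have "geodesic C R (tau R a b) z" using z by (simp add: geodesic_def)
  then show ?thesis using that z by blast
qed

end

section \<open>Mixtures\<close>

text \<open>For \<open>t\<close> in \<open>[0, 1]\<close> this is the convex combination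
  \<open>t p + (1 - t) q\<close>. Its form copies \<open>lazy_measure\<close>, which thereby becomes
  an instance, and lets \<open>map_pmf\<close> commute with it for every \<open>t\<close>.\<close>

definition mix_pmf :: "real \<Rightarrow> 'a pmf \<Rightarrow> 'a pmf \<Rightarrow> 'a pmf" where
  "mix_pmf t p q = bind_pmf (bernoulli_pmf t) (\<lambda>b. if b then p else q)"

lemma pmf_mix_pmf:
  assumes "0 \<le> t" "t \<le> 1"
  shows "pmf (mix_pmf t p q) z = t * pmf p z + (1 - t) * pmf q z"
  using assms by (simp add: mix_pmf_def pmf_bind)

lemma set_mix_pmf_subset: "set_pmf (mix_pmf t p q) \<subseteq> set_pmf p \<union> set_pmf q"
  by (auto simp: mix_pmf_def split: if_splits)

lemma map_mix_pmf: "map_pmf f (mix_pmf t p q) = mix_pmf t (map_pmf f p) (map_pmf f q)"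
  by (simp add: mix_pmf_def map_bind_pmf if_distrib)

lemma expectation_mix_pmf:
  fixes g :: "'a \<Rightarrow> real"
  assumes "0 \<le> t" "t \<le> 1" "finite (set_pmf p)" "finite (set_pmf q)"
  shows "measure_pmf.expectation (mix_pmf t p q) g
    = t * measure_pmf.expectation p g + (1 - t) * measure_pmf.expectation q g"
  unfolding mix_pmf_def
  by (subst pmf_expectation_bind[of UNIV]) (use assms in \<open>auto simp: UNIV_bool\<close>)

lemma mix_mix_pmf:
  assumes "0 \<le> s" "s \<le> 1" "0 \<le> t" "t \<le> 1"
  shows "mix_pmf s p (mix_pmf t p q) = mix_pmf (s + (1 - s) * t) p q"
proof (rule pmf_eqI)
  fix z
  have "s + (1 - s) * t \<le> 1"
    using mult_left_mono[of t 1 "1 - s"] assms by simp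
  then show "pmf (mix_pmf s p (mix_pmf t p q)) z = pmf (mix_pmf (s + (1 - s) * t) p q) z"
    using assms by (simp add: pmf_mix_pmf[of "s + (1 - s) * t"] pmf_mix_pmf[of s] pmf_mix_pmf[of t])
      (simp add: algebra_simps)
qed

lemma lazy_measure_eq_mix_pmf:
  "lazy_measure R \<alpha> x w = mix_pmf \<alpha> (return_pmf x) (pmf_of_set (diamond R x w - {x}))"
  by (simp add: lazy_measure_def mix_pmf_def)

text \<open>The weight is the solution \<open>t\<close> of
  \<open>t + (1 - t) \<alpha> = \<beta>\<close>: adding that much Dirac mass at \<open>x\<close>
  raises the laziness from \<alpha> to \<beta>.\<close>

lemma mix_lazy_measure:
  assumes "0 \<le> \<alpha>" "\<alpha> \<le> \<beta>" "\<beta> < 1"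
  shows "mix_pmf ((\<beta> - \<alpha>) / (1 - \<alpha>)) (return_pmf x) (lazy_measure R \<alpha> x w) = lazy_measure R \<beta> x w"
proof -
  have "(\<beta> - \<alpha>) / (1 - \<alpha>) + (1 - (\<beta> - \<alpha>) / (1 - \<alpha>)) * \<alpha> = \<beta>"
  proof -
    have "t * (1 - \<alpha>) = \<beta> - \<alpha> \<Longrightarrow> t + (1 - t) * \<alpha> = \<beta>" for t
      by (simp add: algebra_simps)
    then show ?thesis using assms by simp
  qed
  moreover have "0 \<le> (\<beta> - \<alpha>) / (1 - \<alpha>)" "(\<beta> - \<alpha>) / (1 - \<alpha>) \<le> 1"
    using assms by (auto simp: field_simps)
  ultimately show ?thesis
    using assms by (simp add: lazy_measure_eq_mix_pmf mix_mix_pmf)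
qed

section \<open>Couplings\<close>

lemma coupling_support:
  assumes "\<pi> \<in> causal_couplings R \<mu> \<nu>" "(a, b) \<in> set_pmf \<pi>"
  shows "a \<in> set_pmf \<mu>" "b \<in> set_pmf \<nu>" "(a, b) \<in> R"
proof -
  have pi: "\<mu> = map_pmf fst \<pi>" "\<nu> = map_pmf snd \<pi>" "\<And>a b. (a, b) \<notin> R \<Longrightarrow> pmf \<pi> (a, b) = 0"
    using assms(1) by (auto simp: causal_couplings_def)
  show "a \<in> set_pmf \<mu>" using assms(2) unfolding pi(1) by (simp add: rev_image_eqI)
  show "b \<in> set_pmf \<nu>" using assms(2) unfolding pi(2) by (simp add: rev_image_eqI)
  show "(a, b) \<in> R" using assms(2) pi(3) by (meson set_pmf_iff)
qed

lemma finite_coupling: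
  assumes "\<pi> \<in> causal_couplings R \<mu> \<nu>" "finite (set_pmf \<mu>)" "finite (set_pmf \<nu>)"
  shows "finite (set_pmf \<pi>)"
proof (rule finite_subset)
  show "set_pmf \<pi> \<subseteq> set_pmf \<mu> \<times> set_pmf \<nu>"
    by (rule subrelI) (simp add: coupling_support(1,2)[OF assms(1)])
qed (simp add: assms)

text \<open>A coupling with a Dirac mass is determined by its other marginal. Hence
  \<open>ell1\<close> from a Dirac mass is a plain expectation, which makes the defect
  computable.\<close>

lemma causal_couplings_return_left:
  assumes "\<And>z. z \<in> set_pmf \<nu> \<Longrightarrow> (x, z) \<in> R"
  shows "causal_couplings R (return_pmf x) \<nu> = {map_pmf (Pair x) \<nu>}"
proof (intro equalityI subsetI)
  fix \<pi> assume pi: "\<pi> \<in> causal_couplings R (return_pmf x) \<nu>"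
  have "(x, snd p) = p" if "p \<in> set_pmf \<pi>" for p
    by (metis coupling_support(1)[OF pi] prod.collapse set_return_pmf singletonD that)
  then have "map_pmf (\<lambda>p. (x, snd p)) \<pi> = \<pi>"
    by (rule pmf.map_ident_strong)
  then have "map_pmf (Pair x) (map_pmf snd \<pi>) = \<pi>"
    by (simp only: map_pmf_comp)
  moreover have "map_pmf snd \<pi> = \<nu>" using pi by (simp add: causal_couplings_def)
  ultimately show "\<pi> \<in> {map_pmf (Pair x) \<nu>}" by (metis singletonI)
next
  fix \<pi> assume "\<pi> \<in> {map_pmf (Pair x) \<nu>}"
  then show "\<pi> \<in> causal_couplings R (return_pmf x) \<nu>"
    using assms by (auto simp: causal_couplings_def map_pmf_comp pmf_eq_0_set_pmf)
qed

lemma causal_couplings_return_right: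
  assumes "\<And>z. z \<in> set_pmf \<mu> \<Longrightarrow> (z, y) \<in> R"
  shows "causal_couplings R \<mu> (return_pmf y) = {map_pmf (\<lambda>z. (z, y)) \<mu>}"
proof (intro equalityI subsetI)
  fix \<pi> assume pi: "\<pi> \<in> causal_couplings R \<mu> (return_pmf y)"
  have "(fst p, y) = p" if "p \<in> set_pmf \<pi>" for p
    by (metis coupling_support(2)[OF pi] prod.collapse set_return_pmf singletonD that)
  then have "map_pmf (\<lambda>p. (fst p, y)) \<pi> = \<pi>"
    by (rule pmf.map_ident_strong)
  then have "map_pmf (\<lambda>z. (z, y)) (map_pmf fst \<pi>) = \<pi>"
    by (simp only: map_pmf_comp)
  moreover have "map_pmf fst \<pi> = \<mu>" using pi by (simp add: causal_couplings_def)
  ultimately show "\<pi> \<in> {map_pmf (\<lambda>z. (z, y)) \<mu>}" by (metis singletonI)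
next
  fix \<pi> assume "\<pi> \<in> {map_pmf (\<lambda>z. (z, y)) \<mu>}"
  then show "\<pi> \<in> causal_couplings R \<mu> (return_pmf y)"
    using assms by (auto simp: causal_couplings_def map_pmf_comp pmf_eq_0_set_pmf)
qed

text \<open>Taking marginals commutes with mixing, so both marginals gain laziness at the same rate,
  and the new atom \<open>(x, y)\<close> is itself a causal pair.\<close>

lemma mix_coupling:
  assumes "0 \<le> \<alpha>" "\<alpha> \<le> \<beta>" "\<beta> < 1" "(x, y) \<in> R"
    and "\<pi> \<in> causal_couplings R (lazy_measure R \<alpha> x v) (lazy_measure R \<alpha> y w)"
  shows "mix_pmf ((\<beta> - \<alpha>) / (1 - \<alpha>)) (return_pmf (x, y)) \<pi>
    \<in> causal_couplings R (lazy_measure R \<beta> x v) (lazy_measure R \<beta> y w)"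
proof -
  let ?\<pi> = "mix_pmf ((\<beta> - \<alpha>) / (1 - \<alpha>)) (return_pmf (x, y)) \<pi>"
  have "set_pmf ?\<pi> \<subseteq> R"
  proof (rule subset_trans[OF set_mix_pmf_subset Un_least])
    show "set_pmf \<pi> \<subseteq> R" by (rule subrelI) (rule coupling_support(3)[OF assms(5)])
  qed (simp add: assms(4))
  moreover have "map_pmf fst ?\<pi> = lazy_measure R \<beta> x v" "map_pmf snd ?\<pi> = lazy_measure R \<beta> y w"
  proof -
    have "map_pmf fst \<pi> = lazy_measure R \<alpha> x v" "map_pmf snd \<pi> = lazy_measure R \<alpha> y w"
      using assms(5) by (simp_all add: causal_couplings_def)
    then show "map_pmf fst ?\<pi> = lazy_measure R \<beta> x v" "map_pmf snd ?\<pi> = lazy_measure R \<beta> y w"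
      by (simp_all only: map_mix_pmf map_return_pmf fst_conv snd_conv mix_lazy_measure[OF assms(1-3)])
  qed
  ultimately show ?thesis
    by (auto simp: causal_couplings_def pmf_eq_0_set_pmf)
qed

section \<open>Left limits of monotone functions\<close>

text \<open>\<open>Lim\<close> yields the limit only if there is one. A nondecreasing function with
  values in \<open>ereal\<close> converges to its supremum from the left, which also inherits the
  bound \<open>c\<close>.\<close>

lemma Lim_at_left_mono_le:
  fixes h :: "real \<Rightarrow> ereal"
  assumes "a < b"
    and mono: "\<And>s t. a < s \<Longrightarrow> s \<le> t \<Longrightarrow> t < b \<Longrightarrow> h s \<le> h t"
    and le: "\<And>s. a < s \<Longrightarrow> s < b \<Longrightarrow> h s \<le> c"
  shows "Lim (at_left b) h \<le> c"
proof -
  let ?l = "SUP s\<in>{a<..<b}. h s"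
  have ev: "eventually (\<lambda>s. s \<in> {d<..<b}) (at_left b)" if "d < b" for d
    using eventually_at_leftI[of d b] that by auto
  have "(h \<longlongrightarrow> ?l) (at_left b)"
  proof (rule increasing_tendsto)
    show "eventually (\<lambda>s. h s \<le> ?l) (at_left b)"
      using ev[OF \<open>a < b\<close>] by eventually_elim (auto intro: SUP_upper)
  next
    fix u assume "u < ?l"
    \<comment> \<open>A value above \<open>u\<close> at \<open>d\<close> persists on all of
      \<open>(d, b)\<close> by monotonicity.\<close>
    then obtain d where d: "a < d" "d < b" "u < h d"
      by (auto simp: less_SUP_iff)
    show "eventually (\<lambda>s. u < h s) (at_left b)"
      using ev[OF d(2)] by eventually_elim (use mono d in \<open>force intro: less_le_trans\<close>)
  qed
  then have "Lim (at_left b) h = ?l"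
    by (rule tendsto_Lim[rotated]) simp
  also have "\<dots> \<le> c" using le by (auto intro: SUP_least)
  finally show ?thesis .
qed

section \<open>Curvature and defect of a geodesic\<close>

text \<open>The sum is split into the points \<open>u i\<close>, where \<open>g\<close> will be
  known exactly, and the remaining ones, each contributing at least 1. In the application
  \<open>u\<close> runs along the geodesic.\<close>

lemma sum_ge_on_image:
  fixes g :: "'a \<Rightarrow> real"
  assumes "finite S" "finite I" "inj_on u I" "u ` I \<subseteq> S" "\<And>z. z \<in> S - u ` I \<Longrightarrow> 1 \<le> g z"
  shows "(\<Sum>i\<in>I. g (u i)) + (real (card S) - real (card I)) \<le> sum g S"
proof -
  have "card (u ` I) \<le> card S" using assms card_mono by blast
  then have "real (card S) - real (card I) = real (card (S - u ` I))"
    using assms by (simp add: card_Diff_subset card_image of_nat_diff)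
  also have "\<dots> = (\<Sum>z\<in>S - u ` I. 1)" by simp
  also have "\<dots> \<le> sum g (S - u ` I)" using assms by (intro sum_mono) auto
  finally have "real (card S) - real (card I) \<le> sum g (S - u ` I)" .
  moreover have "sum g S = sum g (S - u ` I) + sum g (u ` I)"
    using assms by (intro sum.subset_diff) auto
  moreover have "sum g (u ` I) = (\<Sum>i\<in>I. g (u i))"
    using assms by (simp add: sum.reindex)
  ultimately show ?thesis by simp
qed

lemma mean_ge_on_image:
  fixes g :: "'a \<Rightarrow> real"
  assumes "finite S" "S \<noteq> {}" "finite I" "inj_on u I" "u ` I \<subseteq> S"
    "\<And>z. z \<in> S - u ` I \<Longrightarrow> 1 \<le> g z"
  shows "1 + ((\<Sum>i\<in>I. g (u i)) - real (card I)) / real (card S) \<le> sum g S / real (card S)"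
proof -
  have "0 < real (card S)" using assms by (simp add: card_gt_0_iff)
  then have "1 + ((\<Sum>i\<in>I. g (u i)) - real (card I)) / real (card S)
      = ((\<Sum>i\<in>I. g (u i)) + (real (card S) - real (card I))) / real (card S)"
    by (simp add: add_divide_distrib diff_divide_distrib)
  also have "\<dots> \<le> sum g S / real (card S)"
    using sum_ge_on_image[OF assms(1,3-6)] by (intro divide_right_mono) auto
  finally show ?thesis .
qed

context causal
begin

lemma diamond_minus_nonempty:
  assumes "(x, w) \<in> R" "x \<noteq> w"
  shows "diamond R x w - {x} \<noteq> {}"
  using assms refl carrier by (auto simp: diamond_def)

lemma set_lazy_measure:
  assumes "(x, w) \<in> R" "x \<noteq> w"
  shows "set_pmf (lazy_measure R \<alpha> x w) \<subseteq> diamond R x w"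
proof -
  have "x \<in> diamond R x w" using assms refl carrier by (auto simp: diamond_def)
  then show ?thesis
    using set_mix_pmf_subset[of \<alpha> "return_pmf x" "pmf_of_set (diamond R x w - {x})"]
      diamond_minus_nonempty[OF assms] finite_diamond[of x w]
    by (auto simp: lazy_measure_eq_mix_pmf)
qed

lemma finite_set_lazy_measure:
  "(x, w) \<in> R \<Longrightarrow> x \<noteq> w \<Longrightarrow> finite (set_pmf (lazy_measure R \<alpha> x w))"
  using set_lazy_measure finite_diamond finite_subset by metis

lemma expectation_lazy_measure:
  fixes g :: "'a \<Rightarrow> real"
  assumes "(x, w) \<in> R" "x \<noteq> w" "0 \<le> \<alpha>" "\<alpha> \<le> 1"
  shows "measure_pmf.expectation (lazy_measure R \<alpha> x w) g
    = \<alpha> * g x + (1 - \<alpha>) * (sum g (diamond R x w - {x}) / real (card (diamond R x w - {x})))"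
  using assms diamond_minus_nonempty[OF assms(1,2)] finite_diamond[of x w]
  by (simp add: lazy_measure_eq_mix_pmf expectation_mix_pmf integral_pmf_of_set)

lemma card_diamond_minus:
  assumes "(x, w) \<in> R"
  shows "real (card (diamond R x w - {x})) = real (card (diamond R x w)) - 1"
proof -
  have "x \<in> diamond R x w" using assms refl carrier by (auto simp: diamond_def)
  then have "card (diamond R x w) = Suc (card (diamond R x w - {x}))"
    by (rule card.remove[OF finite_diamond])
  then show ?thesis by simp
qed

end

section \<open>A fixed geodesic and its two lazy measures\<close>

locale long_geodesic = causal +
  fixes r n :: nat and x :: "nat \<Rightarrow> 'a"
  assumes r: "1 \<le> r" and n: "r \<le> n" and geo: "geodesic C R (n + r) x"
begin

abbreviation "lazyx \<alpha> \<equiv> lazy_measure R \<alpha> (x 0) (x r)"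
abbreviation "lazyy \<alpha> \<equiv> lazy_measure R \<alpha> (x n) (x (n + r))"

text \<open>These two means are the \<open>a\<close> and \<open>b\<close> of the overview. Both use
  the diamond without its lower endpoint, but \<open>mean_x\<close> measures from that endpoint and
  \<open>mean_y\<close> to the upper one, whence the factors \<open>r - 1\<close> and
  \<open>r - 3\<close> below.\<close>

definition "mean_x =
  (\<Sum>z\<in>diamond R (x 0) (x r) - {x 0}. real (tau R (x 0) z))
    / real (card (diamond R (x 0) (x r) - {x 0}))"

definition "mean_y =
  (\<Sum>z\<in>diamond R (x n) (x (n + r)) - {x n}. real (tau R z (x (n + r))))
    / real (card (diamond R (x n) (x (n + r)) - {x n}))"

lemma le: "i \<le> j \<Longrightarrow> j \<le> n + r \<Longrightarrow> (x i, x j) \<in> R"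
  using geodesic_le[OF geo] .

lemma neq: "i < j \<Longrightarrow> j \<le> n + r \<Longrightarrow> x i \<noteq> x j"
  using inj_onD[OF geodesic_inj[OF geo], of i j] by fastforce

lemma endpoints:
  "(x 0, x r) \<in> R" "x 0 \<noteq> x r" "(x n, x (n + r)) \<in> R" "x n \<noteq> x (n + r)"
  using le neq r by auto

lemma tau_eq: "i \<le> j \<Longrightarrow> j \<le> n + r \<Longrightarrow> tau R (x i) (x j) = j - i"
  using geodesic_tau[OF geo] .

lemma expectation_lazyx:
  assumes "0 \<le> \<alpha>" "\<alpha> \<le> 1"
  shows "measure_pmf.expectation (lazyx \<alpha>) (\<lambda>z. real (tau R (x 0) z)) = (1 - \<alpha>) * mean_x"
  using expectation_lazy_measure[OF endpoints(1,2) assms] tau_eq[of 0 0]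
  by (simp add: mean_x_def)

lemma expectation_lazyy:
  assumes "0 \<le> \<alpha>" "\<alpha> \<le> 1"
  shows "measure_pmf.expectation (lazyy \<alpha>) (\<lambda>z. real (tau R z (x (n + r))))
    = \<alpha> * real r + (1 - \<alpha>) * mean_y"
  using expectation_lazy_measure[OF endpoints(3,4) assms] tau_eq[of n "n + r"]
  by (simp add: mean_y_def)

section \<open>The defect in closed form\<close>

lemma J_defect_eq:
  assumes "0 \<le> \<alpha>" "\<alpha> \<le> 1"
  shows "J_defect R r \<alpha> n x = ereal ((1 - \<alpha>) * (real r - mean_x - mean_y))"
proof -
  have "ell1 R (return_pmf (x 0)) (lazyx \<alpha>) = ereal ((1 - \<alpha>) * mean_x)"
    using set_lazy_measure[OF endpoints(1,2), of \<alpha>] expectation_lazyx[OF assms]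
    by (subst ell1_def, subst causal_couplings_return_left) (auto simp: diamond_def)
  moreover have "ell1 R (lazyy \<alpha>) (return_pmf (x (n + r))) = ereal (\<alpha> * real r + (1 - \<alpha>) * mean_y)"
    using set_lazy_measure[OF endpoints(3,4), of \<alpha>] expectation_lazyy[OF assms]
    by (subst ell1_def, subst causal_couplings_return_right) (auto simp: diamond_def)
  ultimately show ?thesis by (simp add: J_defect_def algebra_simps)
qed

lemma J_LLY_eq: "J_LLY R r n x = ereal (real r - mean_x - mean_y)"
proof -
  have "eventually (\<lambda>\<alpha>::real. 0 < \<alpha> \<and> \<alpha> < 1) (at_left 1)"
    using eventually_at_leftI[of 0 "1::real"] by auto
  then have "eventually (\<lambda>\<alpha>. J_defect R r \<alpha> n x / ereal (1 - \<alpha>) = ereal (real r - mean_x - mean_y))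
      (at_left 1)"
    by eventually_elim (simp add: J_defect_eq)
  then have "((\<lambda>\<alpha>. J_defect R r \<alpha> n x / ereal (1 - \<alpha>)) \<longlongrightarrow> ereal (real r - mean_x - mean_y)) (at_left 1)"
    by (rule tendsto_eventually)
  then show ?thesis unfolding J_LLY_def by (rule tendsto_Lim[rotated]) simp
qed

section \<open>Transport between the lazy measures\<close>

text \<open>For a causal pair \<open>(a, b)\<close> in the support, \<open>x 0\<close>,
  \<open>a\<close>, \<open>b\<close>, \<open>x (n + r)\<close> are successively related, so the
  three time separations sum to at most \<open>n + r\<close>. Integrating leaves expectations that
  depend on the marginals only.\<close>

lemma expectation_coupling_le:
  assumes "0 \<le> \<alpha>" "\<alpha> \<le> 1" and pi: "\<pi> \<in> causal_couplings R (lazyx \<alpha>) (lazyy \<alpha>)"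
  shows "measure_pmf.expectation \<pi> (\<lambda>(a, b). real (tau R a b))
    \<le> real n + (1 - \<alpha>) * (real r - mean_x - mean_y)"
proof -
  have fin: "finite (set_pmf \<pi>)"
    using finite_coupling[OF pi] finite_set_lazy_measure endpoints by blast
  note int = integrable_measure_pmf_finite[OF fin]
  have "measure_pmf.expectation \<pi> (\<lambda>(a, b). real (tau R a b)) \<le>
      measure_pmf.expectation \<pi>
        (\<lambda>p. real (n + r) - real (tau R (x 0) (fst p)) - real (tau R (snd p) (x (n + r))))"
  proof (rule integral_mono_AE[OF int int], rule AE_pmfI)
    fix p assume "p \<in> set_pmf \<pi>"
    then obtain a b where p: "p = (a, b)" and ab: "(a, b) \<in> set_pmf \<pi>" by (metis surj_pair)
    have R: "(a, b) \<in> R" "(x 0, a) \<in> R" "(b, x (n + r)) \<in> R"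
      using coupling_support[OF pi ab] set_lazy_measure endpoints
      by (auto simp: diamond_def)
    have "tau R (x 0) a + tau R a b \<le> tau R (x 0) b"
      using tau_triangle R by blast
    moreover have "tau R (x 0) b + tau R b (x (n + r)) \<le> tau R (x 0) (x (n + r))"
      using tau_triangle R trans by blast
    ultimately have "tau R (x 0) a + tau R a b + tau R b (x (n + r)) \<le> n + r"
      using tau_eq[of 0 "n + r"] by simp
    then have "real (tau R (x 0) a) + real (tau R a b) + real (tau R b (x (n + r))) \<le> real (n + r)"
      by (metis of_nat_add of_nat_le_iff)
    then show "(case p of (a, b) \<Rightarrow> real (tau R a b)) \<le>
        real (n + r) - real (tau R (x 0) (fst p)) - real (tau R (snd p) (x (n + r)))"
      by (simp add: p)
  qed
  also have "\<dots> = real (n + r)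
      - measure_pmf.expectation (map_pmf fst \<pi>) (\<lambda>a. real (tau R (x 0) a))
      - measure_pmf.expectation (map_pmf snd \<pi>) (\<lambda>b. real (tau R b (x (n + r))))"
    by (simp add: int)
  also have "\<dots> = real n + (1 - \<alpha>) * (real r - mean_x - mean_y)"
    using pi assms expectation_lazyx expectation_lazyy
    by (simp add: causal_couplings_def algebra_simps)
  finally show ?thesis .
qed

lemma ell1_le:
  assumes "0 \<le> \<alpha>" "\<alpha> \<le> 1"
  shows "ell1 R (lazyx \<alpha>) (lazyy \<alpha>) \<le> ereal (real n + (1 - \<alpha>) * (real r - mean_x - mean_y))"
  unfolding ell1_def using expectation_coupling_le[OF assms] by (auto intro: SUP_least)

text \<open>Mixing any coupling at laziness \<alpha> with the Dirac mass at
  \<open>(x 0, x n)\<close>, whose cost is \<open>n\<close>, gives a competitor at laziness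
  \<beta>.\<close>

lemma ell1_concave:
  assumes "0 \<le> \<alpha>" "\<alpha> \<le> \<beta>" "\<beta> < 1" "ell1 R (lazyx \<alpha>) (lazyy \<alpha>) = ereal u"
  obtains v where "ell1 R (lazyx \<beta>) (lazyy \<beta>) = ereal v"
    "(1 - \<beta>) / (1 - \<alpha>) * u + (\<beta> - \<alpha>) / (1 - \<alpha>) * real n \<le> v"
proof -
  let ?E = "\<lambda>\<pi>. measure_pmf.expectation \<pi> (\<lambda>(a, b). real (tau R a b))"
  define t where "t = (\<beta> - \<alpha>) / (1 - \<alpha>)"
  have t: "0 \<le> t" "t < 1" "1 - t = (1 - \<beta>) / (1 - \<alpha>)"
    using assms by (auto simp: t_def field_simps)
  have mix: "ereal (t * real n + (1 - t) * ?E \<pi>) \<le> ell1 R (lazyx \<beta>) (lazyy \<beta>)"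
    if pi: "\<pi> \<in> causal_couplings R (lazyx \<alpha>) (lazyy \<alpha>)" for \<pi>
  proof -
    have fin: "finite (set_pmf \<pi>)"
      using finite_coupling[OF pi] finite_set_lazy_measure endpoints by blast
    have "?E (mix_pmf t (return_pmf (x 0, x n)) \<pi>) = t * real n + (1 - t) * ?E \<pi>"
      using t fin tau_eq[of 0 n] by (subst expectation_mix_pmf) auto
    moreover have "mix_pmf t (return_pmf (x 0, x n)) \<pi> \<in> causal_couplings R (lazyx \<beta>) (lazyy \<beta>)"
      unfolding t_def using mix_coupling[OF assms(1-3) le pi] by simp
    ultimately show ?thesis
      unfolding ell1_def by (metis (mono_tags, lifting) SUP_upper)
  qed
  \<comment> \<open>Over the empty set the supremum would be minus infinity, not the real number
    \<open>u\<close>.\<close>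
  have "causal_couplings R (lazyx \<alpha>) (lazyy \<alpha>) \<noteq> {}"
    using assms(4) by (auto simp: ell1_def bot_ereal_def)
  then obtain \<pi> where "\<pi> \<in> causal_couplings R (lazyx \<alpha>) (lazyy \<alpha>)" by blast
  \<comment> \<open>The competitor rules out minus infinity and \<open>ell1_le\<close> rules out
    plus infinity.\<close>
  from mix[OF this] obtain v where v: "ell1 R (lazyx \<beta>) (lazyy \<beta>) = ereal v"
    using ell1_le[of \<beta>] assms by (cases "ell1 R (lazyx \<beta>) (lazyy \<beta>)") auto
  \<comment> \<open>Solving for the cost of a coupling at \<alpha> gives a bound uniform in the
    coupling, which passes to the supremum \<open>u\<close>.\<close>
  have "?E \<pi> \<le> (v - t * real n) / (1 - t)"
    if "\<pi> \<in> causal_couplings R (lazyx \<alpha>) (lazyy \<alpha>)" for \<pi>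
  proof -
    have "t * real n + (1 - t) * ?E \<pi> \<le> v"
      using mix[OF that] unfolding v by (simp only: ereal_less_eq)
    then show ?thesis using t(2) by (simp add: pos_le_divide_eq algebra_simps)
  qed
  then have "ell1 R (lazyx \<alpha>) (lazyy \<alpha>) \<le> ereal ((v - t * real n) / (1 - t))"
    unfolding ell1_def by (auto intro: SUP_least)
  then have "(1 - t) * u + t * real n \<le> v"
    using t(2) by (simp add: assms(4) field_simps)
  then show ?thesis using that[OF v] t(3) by (simp add: t_def)
qed

section \<open>Curvature quotients and their limit\<close>

lemma kappa_eq:
  assumes "ell1 R (lazyx \<alpha>) (lazyy \<alpha>) = ereal u" "\<alpha> < 1"
  shows "kappa R r \<alpha> n x / ereal (1 - \<alpha>) = ereal ((u / real n - 1) / (1 - \<alpha>))"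
  using assms n r tau_eq[of 0 n] by (simp add: kappa_def one_ereal_def)

text \<open>This is the case without causal couplings. Being the least value, it makes both
  monotonicity and the upper bound trivial there.\<close>

lemma kappa_minus_infinity:
  assumes "ell1 R (lazyx \<alpha>) (lazyy \<alpha>) = -\<infinity>" "\<alpha> < 1"
  shows "kappa R r \<alpha> n x / ereal (1 - \<alpha>) = -\<infinity>"
  using assms n r tau_eq[of 0 n] by (simp add: kappa_def one_ereal_def)

text \<open>By \<open>ell1_concave\<close>, the excess of \<open>ell1\<close> over \<open>n\<close>
  shrinks at most in proportion to \<open>1 - \<alpha>\<close> when positive and at least so when
  negative, so its quotient by \<open>1 - \<alpha>\<close> cannot drop.\<close>

lemma kappa_quotient_mono:
  assumes "0 \<le> \<alpha>" "\<alpha> \<le> \<beta>" "\<beta> < 1"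
  shows "kappa R r \<alpha> n x / ereal (1 - \<alpha>) \<le> kappa R r \<beta> n x / ereal (1 - \<beta>)"
proof (cases "ell1 R (lazyx \<alpha>) (lazyy \<alpha>)")
  case (real u)
  obtain v where v: "ell1 R (lazyx \<beta>) (lazyy \<beta>) = ereal v"
    "(1 - \<beta>) / (1 - \<alpha>) * u + (\<beta> - \<alpha>) / (1 - \<alpha>) * real n \<le> v"
    using ell1_concave[OF assms real] .
  have pos: "0 < real n" using n r by simp
  have "((1 - \<beta>) * u + (\<beta> - \<alpha>) * real n) / (1 - \<alpha>) \<le> v"
    using v(2) by (simp add: add_divide_distrib)
  then have "(1 - \<beta>) * u + (\<beta> - \<alpha>) * real n \<le> v * (1 - \<alpha>)"
    using assms by (simp add: pos_divide_le_eq)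
  \<comment> \<open>Subtract \<open>(1 - \<alpha>) n\<close>, written as
    \<open>(1 - \<beta>) n + (\<beta> - \<alpha>) n\<close> on the left.\<close>
  then have "(1 - \<beta>) * (u - real n) \<le> (v - real n) * (1 - \<alpha>)"
    by (simp add: algebra_simps)
  then have "(u - real n) / (1 - \<alpha>) \<le> (v - real n) / (1 - \<beta>)"
    using assms by (simp add: field_simps)
  then have "(u - real n) / (1 - \<alpha>) / real n \<le> (v - real n) / (1 - \<beta>) / real n"
    by (rule divide_right_mono) simp
  moreover have "(u / real n - 1) / (1 - \<alpha>) = (u - real n) / (1 - \<alpha>) / real n"
    "(v / real n - 1) / (1 - \<beta>) = (v - real n) / (1 - \<beta>) / real n"
    using pos assms by (simp_all add: diff_divide_distrib)
  ultimately show ?thesis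
    using kappa_eq[OF real] kappa_eq[OF v(1)] assms by simp
next
  case PInf
  then show ?thesis using ell1_le[of \<alpha>] assms by simp
next
  case MInf
  then show ?thesis using kappa_minus_infinity assms by simp
qed

lemma kappa_quotient_le:
  assumes "0 \<le> \<alpha>" "\<alpha> < 1"
  shows "kappa R r \<alpha> n x / ereal (1 - \<alpha>) \<le> ereal ((real r - mean_x - mean_y) / real n)"
proof (cases "ell1 R (lazyx \<alpha>) (lazyy \<alpha>)")
  case (real u)
  have pos: "0 < real n" using n r by simp
  have "u \<le> real n + (1 - \<alpha>) * (real r - mean_x - mean_y)"
    using ell1_le[of \<alpha>] assms real by simp
  then have "(u - real n) / (1 - \<alpha>) \<le> real r - mean_x - mean_y"
    using assms by (simp add: pos_divide_le_eq mult.commute)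
  then have "(u - real n) / (1 - \<alpha>) / real n \<le> (real r - mean_x - mean_y) / real n"
    by (rule divide_right_mono) simp
  moreover have "(u / real n - 1) / (1 - \<alpha>) = (u - real n) / (1 - \<alpha>) / real n"
    using pos by (simp add: diff_divide_distrib)
  ultimately show ?thesis
    using kappa_eq[OF real] assms by simp
next
  case PInf
  then show ?thesis using ell1_le[of \<alpha>] assms by simp
next
  case MInf
  then show ?thesis using kappa_minus_infinity assms by simp
qed

lemma kappa_LLY_le: "kappa_LLY R r n x \<le> ereal ((real r - mean_x - mean_y) / real n)"
  unfolding kappa_LLY_def
  by (rule Lim_at_left_mono_le[of 0]) (use kappa_quotient_mono kappa_quotient_le in auto)

lemma tau_le_J_LLY:
  assumes "0 < K" "ereal K \<le> kappa_LLY R r n x"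
  shows "ereal (real (n + r)) \<le> ereal (real r) + J_LLY R r n x / ereal K"
proof -
  have "ereal K \<le> ereal ((real r - mean_x - mean_y) / real n)"
    using kappa_LLY_le assms(2) order_trans by blast
  then have "K \<le> (real r - mean_x - mean_y) / real n" by simp
  then have "real n \<le> (real r - mean_x - mean_y) / K"
    using n r assms(1) by (simp add: field_simps)
  then show ?thesis using assms(1) by (simp add: J_LLY_eq)
qed

section \<open>Estimates of the two means\<close>

text \<open>The segment \<open>x 0, ..., x r\<close> alone supplies \<open>r + 1\<close> points, so
  the denominators \<open>card - 1\<close> below are at least \<open>r\<close>.\<close>

lemma card_x: "real r + 1 \<le> real (card (diamond R (x 0) (x r)))"
  using chain_length_less_card[of r x] geo by (force simp: geodesic_def causal_chain_def)

lemma card_y: "real r + 1 \<le> real (card (diamond R (x n) (x (n + r))))"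
  using chain_length_less_card[of r "\<lambda>l. x (n + l)"] geo
  by (force simp: geodesic_def causal_chain_def)

lemma sum_naturals: "(\<Sum>i\<in>{1..r}. real i) = real r * (real r + 1) / 2"
  by (induction r) (auto simp: field_simps)

text \<open>The geodesic points contribute \<open>1, ..., r\<close>, which exceeds the baseline of 1
  per point by \<open>r (r + 1) / 2 - r = r (r - 1) / 2\<close>.\<close>

lemma mean_x_ge:
  "1 + real r * (real r - 1) / (2 * (real (card (diamond R (x 0) (x r))) - 1)) \<le> mean_x"
proof -
  let ?S = "diamond R (x 0) (x r) - {x 0}"
  have "1 + ((\<Sum>i\<in>{1..r}. real (tau R (x 0) (x i))) - real (card {1..r})) / real (card ?S) \<le> mean_x"
    unfolding mean_x_def
  proof (rule mean_ge_on_image)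
    show "inj_on x {1..r}" by (rule inj_on_subset[OF geodesic_inj[OF geo]]) auto
    show "x ` {1..r} \<subseteq> ?S"
    proof (rule image_subsetI)
      fix i assume "i \<in> {1..r}"
      then show "x i \<in> ?S" using le[of 0 i] le[of i r] neq[of 0 i] by (simp add: diamond_def)
    qed
    show "1 \<le> real (tau R (x 0) z)" if "z \<in> ?S - x ` {1..r}" for z
    proof -
      have "(x 0, z) \<in> R" "x 0 \<noteq> z" using that by (auto simp: diamond_def)
      then show ?thesis using tau_ge_1 by simp
    qed
    show "?S \<noteq> {}" by (rule diamond_minus_nonempty[OF endpoints(1,2)])
  qed (simp_all add: finite_diamond)
  moreover have "(\<Sum>i\<in>{1..r}. real (tau R (x 0) (x i))) = (\<Sum>i\<in>{1..r}. real i)"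
  proof (rule sum.cong[OF HOL.refl])
    fix i assume "i \<in> {1..r}"
    then show "real (tau R (x 0) (x i)) = real i" by (simp add: tau_eq)
  qed
  moreover have "(\<Sum>i\<in>{1..r}. real i) - real (card {1..r}) = real r * (real r - 1) / 2"
    unfolding sum_naturals by (simp add: field_simps)
  ultimately show ?thesis
    by (simp only: card_diamond_minus[OF endpoints(1)] divide_divide_eq_left)
qed

text \<open>The geodesic points contribute \<open>r - 1, ..., 0\<close>, so the excess over 1 per
  point is \<open>r (r - 1) / 2 - r = r (r - 3) / 2\<close>, negative for
  \<open>r = 2\<close>.\<close>

lemma mean_y_ge:
  "1 + real r * (real r - 3) / (2 * (real (card (diamond R (x n) (x (n + r)))) - 1)) \<le> mean_y"
proof -
  let ?S = "diamond R (x n) (x (n + r)) - {x n}"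
  have "1 + ((\<Sum>i\<in>{1..r}. real (tau R (x (n + i)) (x (n + r)))) - real (card {1..r}))
      / real (card ?S) \<le> mean_y"
    unfolding mean_y_def
  proof (rule mean_ge_on_image)
    show "inj_on (\<lambda>i. x (n + i)) {1..r}"
      by (rule inj_onI) (use inj_onD[OF geodesic_inj[OF geo]] in fastforce)
    show "(\<lambda>i. x (n + i)) ` {1..r} \<subseteq> ?S"
    proof (rule image_subsetI)
      fix i assume "i \<in> {1..r}"
      then show "x (n + i) \<in> ?S"
        using le[of n "n + i"] le[of "n + i" "n + r"] neq[of n "n + i"] by (simp add: diamond_def)
    qed
    show "1 \<le> real (tau R z (x (n + r)))" if z: "z \<in> ?S - (\<lambda>i. x (n + i)) ` {1..r}" for z
    proof -
      \<comment> \<open>The one point at time separation 0 from the upper end is that end itself,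
        and it lies in the image as the index \<open>r\<close>.\<close>
      have "z \<noteq> x (n + r)" using z r by auto
      then show ?thesis using tau_ge_1[of z "x (n + r)"] z by (simp add: diamond_def)
    qed
    show "?S \<noteq> {}" by (rule diamond_minus_nonempty[OF endpoints(3,4)])
  qed (simp_all add: finite_diamond)
  moreover have "(\<Sum>i\<in>{1..r}. real (tau R (x (n + i)) (x (n + r)))) = (\<Sum>i\<in>{1..r}. real r - real i)"
  proof (rule sum.cong[OF HOL.refl])
    fix i assume "i \<in> {1..r}"
    then show "real (tau R (x (n + i)) (x (n + r))) = real r - real i"
      by (simp add: tau_eq of_nat_diff)
  qed
  moreover have "(\<Sum>i\<in>{1..r}. real r - real i) - real (card {1..r}) = real r * (real r - 3) / 2"
    unfolding sum_subtractf sum_naturals by (simp add: field_simps)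
  ultimately show ?thesis
    by (simp only: card_diamond_minus[OF endpoints(3)] divide_divide_eq_left)
qed

lemma J_LLY_le:
  "J_LLY R r n x \<le>
    ereal (real r - 2 - real r * (real r - 1) / (2 * (real (card (diamond R (x 0) (x r))) - 1))
      - real r * (real r - 3) / (2 * (real (card (diamond R (x n) (x (n + r)))) - 1)))"
  using mean_x_ge mean_y_ge by (simp add: J_LLY_eq)

end

section \<open>Diameter bound and explicit constants\<close>

theorem theorem3p11:
  fixes C :: "'a set" and R :: "'a rel" and r :: nat and K :: real
  assumes "causal_set C R" and "r \<ge> 2" and "K > 0"
    and "\<And>n x. n \<ge> r \<Longrightarrow> geodesic C R (n + r) x \<Longrightarrow> kappa_LLY R r n x \<ge> ereal K"
  shows
    "(\<forall>n x. n \<ge> r \<and> geodesic C R (n + r) x \<longrightarrow>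
        ereal (real (tau R (x 0) (x (n + r)))) \<le> ereal (real r) + J_LLY R r n x / ereal K)
    \<and> (diam_tau R \<ge> enat (2 * r) \<longrightarrow>
        ereal_of_enat (diam_tau R) \<le>
          ereal (real r)
          + (SUP (n, x)\<in>{(n, x). n \<ge> r \<and> geodesic C R (n + r) x}. J_LLY R r n x) / ereal K)
    \<and> (\<forall>n x. n \<ge> r \<and> geodesic C R (n + r) x \<longrightarrow>
        (let N\<^sub>x = real (card (diamond R (x 0) (x r)));
             N\<^sub>y = real (card (diamond R (x n) (x (n + r))))
         in (r = 2 \<longrightarrow>
               J_LLY R r n x \<le> ereal (1 / (N\<^sub>y - 1) - 1 / (N\<^sub>x - 1))
               \<and> 1 / (N\<^sub>y - 1) - 1 / (N\<^sub>x - 1) \<le> 1 / 2)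
          \<and> (r > 2 \<longrightarrow>
               J_LLY R r n x \<le>
                 ereal (real r - 2 - real r * (real r - 1) / (2 * (N\<^sub>x - 1))
                        - real r * (real r - 3) / (2 * (N\<^sub>y - 1)))
               \<and> real r - 2 - real r * (real r - 1) / (2 * (N\<^sub>x - 1))
                   - real r * (real r - 3) / (2 * (N\<^sub>y - 1)) < real r - 2)))"
proof -
  interpret causal C R by unfold_locales (rule assms(1))
  have long: "long_geodesic C R r n x" if "n \<ge> r" "geodesic C R (n + r) x" for n x
    using that assms(2) by unfold_locales auto
  have tau_le: "ereal (real (tau R (x 0) (x (n + r)))) \<le> ereal (real r) + J_LLY R r n x / ereal K"
    if "n \<ge> r" "geodesic C R (n + r) x" for n x
    using long_geodesic.tau_le_J_LLY[OF long[OF that] assms(3) assms(4)[OF that]]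
      geodesic_tau[OF that(2), of 0 "n + r"] by simp
  let ?S = "SUP (n, x)\<in>{(n, x). n \<ge> r \<and> geodesic C R (n + r) x}. J_LLY R r n x"
  have diam: "ereal_of_enat (diam_tau R) \<le> ereal (real r) + ?S / ereal K"
    if d: "diam_tau R \<ge> enat (2 * r)"
  proof -
    have pair: "ereal (real (tau R a b)) \<le> ereal (real r) + ?S / ereal K"
      if ab: "(a, b) \<in> R" "2 * r \<le> tau R a b" for a b
    proof -
      obtain x where x: "geodesic C R (tau R a b) x" "x 0 = a" "x (tau R a b) = b"
        using geodesic_exists[OF ab(1)] .
      \<comment> \<open>A separation of at least \<open>2 * r\<close> leaves room for
        \<open>n \<ge> r\<close> after reserving the last \<open>r\<close> links.\<close>
      define n where "n = tau R a b - r"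
      have n: "tau R a b = n + r" "n \<ge> r" using ab(2) by (auto simp: n_def)
      have "J_LLY R r n x \<le> ?S"
        using n x by (intro SUP_upper2[of "(n, x)"]) auto
      then have "J_LLY R r n x / ereal K \<le> ?S / ereal K"
        using assms(3) by (intro ereal_divide_right_mono) auto
      then have "ereal (real r) + J_LLY R r n x / ereal K \<le> ereal (real r) + ?S / ereal K"
        by (rule add_left_mono)
      then show ?thesis using tau_le[of n x] n x order_trans by fastforce
    qed
    \<comment> \<open>One such pair suffices: it also dominates every pair of separation below
      \<open>2 * r\<close>, to which the geodesic bound does not apply directly.\<close>
    have "\<exists>(a, b)\<in>R. 2 * r \<le> tau R a b"
    proof (rule ccontr)
      assume "\<not> ?thesis"
      then have "\<And>a b. (a, b) \<in> R \<Longrightarrow> tau R a b \<le> 2 * r - 1" by fastforce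
      then have "diam_tau R \<le> enat (2 * r - 1)"
        by (auto simp: diam_tau_def intro!: SUP_least)
      then show False using d assms(2) order_trans[OF d] by fastforce
    qed
    then obtain a b where ab: "(a, b) \<in> R" "2 * r \<le> tau R a b" by blast
    have "ereal (real (tau R c d)) \<le> ereal (real r) + ?S / ereal K" if cd: "(c, d) \<in> R" for c d
    proof (cases "2 * r \<le> tau R c d")
      case True
      then show ?thesis using pair cd by blast
    next
      case False
      then have "ereal (real (tau R c d)) \<le> ereal (real (tau R a b))" using ab(2) by simp
      then show ?thesis using pair[OF ab] order_trans by blast
    qed
    moreover have "ereal_of_enat (diam_tau R) = (SUP (c, d)\<in>R. ereal_of_enat (enat (tau R c d)))"
      unfolding diam_tau_def using ab(1)
      \<comment> \<open>The conversion commutes with the supremum because the index set contains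
        \<open>(a, b)\<close>.\<close>
      by (subst ereal_of_enat_SUP) (auto simp: case_prod_unfold)
    ultimately show ?thesis by (auto intro!: SUP_least)
  qed
  have bounds: "let N\<^sub>x = real (card (diamond R (x 0) (x r)));
             N\<^sub>y = real (card (diamond R (x n) (x (n + r))))
         in (r = 2 \<longrightarrow>
               J_LLY R r n x \<le> ereal (1 / (N\<^sub>y - 1) - 1 / (N\<^sub>x - 1))
               \<and> 1 / (N\<^sub>y - 1) - 1 / (N\<^sub>x - 1) \<le> 1 / 2)
          \<and> (r > 2 \<longrightarrow>
               J_LLY R r n x \<le>
                 ereal (real r - 2 - real r * (real r - 1) / (2 * (N\<^sub>x - 1))
                        - real r * (real r - 3) / (2 * (N\<^sub>y - 1)))
               \<and> real r - 2 - real r * (real r - 1) / (2 * (N\<^sub>x - 1))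
                   - real r * (real r - 3) / (2 * (N\<^sub>y - 1)) < real r - 2)"
    if nx: "n \<ge> r" "geodesic C R (n + r) x" for n x
  proof -
    interpret long_geodesic C R r n x by (rule long[OF nx])
    define Nx Ny where "Nx = real (card (diamond R (x 0) (x r)))"
      and "Ny = real (card (diamond R (x n) (x (n + r))))"
    have N: "real r + 1 \<le> Nx" "real r + 1 \<le> Ny" using card_x card_y by (auto simp: Nx_def Ny_def)
    have J: "J_LLY R r n x \<le> ereal (real r - 2 - real r * (real r - 1) / (2 * (Nx - 1))
        - real r * (real r - 3) / (2 * (Ny - 1)))"
      using J_LLY_le by (simp add: Nx_def Ny_def)
    have two: "J_LLY R r n x \<le> ereal (1 / (Ny - 1) - 1 / (Nx - 1)) \<and> 1 / (Ny - 1) - 1 / (Nx - 1) \<le> 1 / 2"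
      if "r = 2"
    proof
      \<comment> \<open>For \<open>r = 2\<close> the factor \<open>r - 3\<close> is -1, which turns
        the last term into a positive \<open>1 / (Ny - 1)\<close>.\<close>
      have "real r - 2 - real r * (real r - 1) / (2 * (Nx - 1))
          - real r * (real r - 3) / (2 * (Ny - 1)) = 1 / (Ny - 1) - 1 / (Nx - 1)"
      proof -
        have "2 - 2 - 2 * (2 - 1) / (2 * u) - 2 * (2 - 3) / (2 * v) = 1 / v - 1 / u" for u v :: real
          by simp
        then show ?thesis unfolding that of_nat_numeral .
      qed
      then show "J_LLY R r n x \<le> ereal (1 / (Ny - 1) - 1 / (Nx - 1))" using J by metis
      \<comment> \<open>Here \<open>Ny \<ge> r + 1 = 3\<close>.\<close>
      have "1 / (Ny - 1) \<le> 1 / 2" "0 \<le> 1 / (Nx - 1)" using that N by (auto intro!: divide_left_mono)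
      then show "1 / (Ny - 1) - 1 / (Nx - 1) \<le> 1 / 2" by linarith
    qed
    have "real r - 2 - real r * (real r - 1) / (2 * (Nx - 1))
        - real r * (real r - 3) / (2 * (Ny - 1)) < real r - 2" if "r > 2"
    proof -
      \<comment> \<open>From \<open>r \<ge> 3\<close> on, the \<open>Ny\<close> term no longer has
        the wrong sign, and strictness comes from the \<open>Nx\<close> term.\<close>
      have "0 < real r * (real r - 1) / (2 * (Nx - 1))" "0 \<le> real r * (real r - 3) / (2 * (Ny - 1))"
        using that N by auto
      then show ?thesis by linarith
    qed
    then show ?thesis using two J by (simp add: Let_def flip: Nx_def Ny_def)
  qed
  show ?thesis using tau_le diam bounds by blast
qed

end
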